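(* Let $\Omega\subset\mathbb{R}^n$ be an open set and $f=(\mathsf{z},\mathsf{t}):\Omega\to\mathbb{H}^1$ a harmonic curve, with $\mathsf{z}=H\circ\mathsf{y}+i\mathsf{y}$. Then the function $u:=|\mathsf{z}|$ satisfies $$\Delta u+\frac{|\nabla u|^2}{u}\ge0$$ at the points of $\Omega$ where $|\mathsf{z}|\neq0$, provided that $H$ satisfies $$H''(s)\big(H(s)-sH'(s)\big)\ge0$$ for all $s$ in the range of $\mathsf{y}$. In particular, the differential inequality for $u$ holds if $H$ is nonnegative and $H'\le0$, $H''\ge0$.
   Context: The first Heisenberg group $\mathbb{H}^1$ is $\mathbb{R}^3$ with coordinates $(\mathsf{x},\mathsf{y},\mathsf{t})$ and contact form $\theta=d\mathsf{t}+2(\mathsf{x}\,d\mathsf{y}-\mathsf{y}\,d\mathsf{x})$. Let $\Omega\subset\mathbb{R}^n$ be open. A harmonic curve (also called $C^2$-harmonic mapping) is a $C^2$ map $f=(\mathsf{x},\mathsf{y},\mathsf{t}):\Omega\to\mathbb{H}^1$, also written $f=(\mathsf{z},\mathsf{t})$ with $\mathsf{z}=\mathsf{x}+i\mathsf{y}$, such that: (1) (isotropicity) $\frac{\partial\mathsf{x}}{\partial x_\alpha}\frac{\partial\mathsf{y}}{\partial x_\beta}-\frac{\partial\mathsf{x}}{\partial x_\beta}\frac{\partial\mathsf{y}}{\partial x_\alpha}=0$ for all $\alpha<\beta$, and the contact condition $f^*\theta=0$ holds, i.e. $\nabla\mathsf{t}=2(\mathsf{y}\nabla\mathsf{x}-\mathsf{x}\nabla\mathsf{y})$;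 (2) (criticality) $\mathsf{z}$ is a critical point of $E^2(f)=\int_\Omega|\nabla\mathsf{z}|^2dx$, where $|\nabla\mathsf{z}|^2=|\nabla\mathsf{x}|^2+|\nabla\mathsf{y}|^2$, with respect to domain variations $\mathsf{z}_s(x)=\mathsf{z}(x+s\xi(x))$, $\xi\in C_0^\infty(\Omega,\mathbb{R}^n)$; that is, for all $\phi\in C_0^\infty(\Omega)$ and $\gamma=1,\dots,n$, $$\int_\Omega\Big(|\nabla\mathsf{z}|^2\frac{\partial\phi}{\partial x_\gamma}-2\sum_{\beta=1}^n\Big(\frac{\partial\mathsf{x}}{\partial x_\beta}\frac{\partial\mathsf{x}}{\partial x_\gamma}+\frac{\partial\mathsf{y}}{\partial x_\beta}\frac{\partial\mathsf{y}}{\partial x_\gamma}\Big)\frac{\partial\phi}{\partial x_\beta}\Big)dx=0.$$ Throughout, $\mathsf{x}=H\circ\mathsf{y}$ for a $C^2$ function $H:I\to\mathbb{R}$ on an interval $I\supset\mathsf{y}(\Omega)$. For such maps, criticality is equivalent to $$\Delta\mathsf{y}=-\frac{(H''\circ\mathsf{y})(H'\circ\mathsf{y})}{1+(H'\circ\mathsf{y})^2}|\nabla\mathsf{y}|^2\quad\text{in }\Omega.$$ Here $|\mathsf{z}|=(\mathsf{x}^2+\mathsf{y}^2)^{1/2}$.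
   Formalization: In the "in particular" clause, the range of y is additionally assumed to lie in [0,∞); without this the clause is false, e.g. n=1, z = (1−cos θ) + i(−100−sin θ), π/4<θ<π/3. *)

theory Defs
  imports "HOL-Analysis.Analysis"
begin

text \<open>Continuous differentiability of order k, for open sets \<open>S\<close>.\<close>

fun C_on :: "nat \<Rightarrow> 'a::real_normed_vector set \<Rightarrow> ('a \<Rightarrow> 'b::real_normed_vector) \<Rightarrow> bool" where
  "C_on 0 S f \<longleftrightarrow> continuous_on S f"
| "C_on (Suc k) S f \<longleftrightarrow>
     (\<forall>p\<in>S. f differentiable (at p)) \<and> (\<forall>v. C_on k S (\<lambda>p. frechet_derivative f (at p) v))"

definition test_function :: "'a::real_normed_vector set \<Rightarrow> ('a \<Rightarrow> real) \<Rightarrow> bool" where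
  "test_function S \<phi> \<longleftrightarrow>
     (\<forall>k. C_on k UNIV \<phi>) \<and> compact (closure {p. \<phi> p \<noteq> 0}) \<and> closure {p. \<phi> p \<noteq> 0} \<subseteq> S"

definition partial :: "'n::finite \<Rightarrow> (real^'n \<Rightarrow> real) \<Rightarrow> real^'n \<Rightarrow> real" where
  "partial i g p = frechet_derivative g (at p) (axis i 1)"

definition grad :: "(real^'n::finite \<Rightarrow> real) \<Rightarrow> real^'n \<Rightarrow> real^'n" where
  "grad g p = (\<chi> i. partial i g p)"

definition laplacian :: "(real^'n::finite \<Rightarrow> real) \<Rightarrow> real^'n \<Rightarrow> real" where
  "laplacian g p = (\<Sum>i\<in>UNIV. partial i (partial i g) p)"

text \<open>The underlying manifold of the first Heisenberg group, with coordinates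
  \<open>(z, t)\<close>, \<open>z = x + i y\<close>.\<close>

type_synonym heisenberg = "complex \<times> real"

abbreviation zc :: "('a \<Rightarrow> heisenberg) \<Rightarrow> 'a \<Rightarrow> complex" where "zc f p \<equiv> fst (f p)"
abbreviation xc :: "('a \<Rightarrow> heisenberg) \<Rightarrow> 'a \<Rightarrow> real" where "xc f p \<equiv> Re (fst (f p))"
abbreviation yc :: "('a \<Rightarrow> heisenberg) \<Rightarrow> 'a \<Rightarrow> real" where "yc f p \<equiv> Im (fst (f p))"

text \<open>The form \<open>dt + 2 (x dy - y dx)\<close> at the point \<open>q\<close>, evaluated on the tangent vector \<open>w\<close>.\<close>

definition contact_form :: "heisenberg \<Rightarrow> heisenberg \<Rightarrow> real" where
  "contact_form q w = snd w + 2 * (Re (fst q) * Im (fst w) - Im (fst q) * Re (fst w))"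

definition contact_map :: "(real^'n::finite) set \<Rightarrow> (real^'n \<Rightarrow> heisenberg) \<Rightarrow> bool" where
  "contact_map \<Omega> f \<longleftrightarrow>
     (\<forall>p\<in>\<Omega>. \<forall>v. contact_form (f p) (frechet_derivative f (at p) v) = 0)"

text \<open>The index type is not ordered; the condition is antisymmetric in \<open>\<alpha>\<close> and \<open>\<beta>\<close>, so imposing it
  for all pairs is the same as imposing it for \<open>\<alpha> < \<beta>\<close>.\<close>

definition isotropic_map :: "(real^'n::finite) set \<Rightarrow> (real^'n \<Rightarrow> heisenberg) \<Rightarrow> bool" where
  "isotropic_map \<Omega> f \<longleftrightarrow>
     (\<forall>p\<in>\<Omega>. \<forall>\<alpha> \<beta>. partial \<alpha> (xc f) p * partial \<beta> (yc f) p
                  - partial \<beta> (xc f) p * partial \<alpha> (yc f) p = 0)"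

definition energy_density :: "(real^'n::finite \<Rightarrow> heisenberg) \<Rightarrow> real^'n \<Rightarrow> real" where
  "energy_density f p = (norm (grad (xc f) p))\<^sup>2 + (norm (grad (yc f) p))\<^sup>2"

text \<open>First variation of the energy (the integral of \<open>energy_density\<close>) under the domain variations
  \<open>z (p + s *\<^sub>R \<xi> p)\<close>, with \<open>\<xi>\<close> the test function \<open>\<phi>\<close> times the coordinate vector of index \<open>\<gamma>\<close>.
  The integrand is continuous with compact support in \<open>\<Omega>\<close>, so the identity makes sense without
  assuming finite energy.\<close>

definition critical_map :: "(real^'n::finite) set \<Rightarrow> (real^'n \<Rightarrow> heisenberg) \<Rightarrow> bool" where
  "critical_map \<Omega> f \<longleftrightarrow>
     (\<forall>\<phi> \<gamma>. test_function \<Omega> \<phi> \<longrightarrow>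
        (LINT p:\<Omega>|lborel.
            energy_density f p * partial \<gamma> \<phi> p
            - 2 * (\<Sum>\<beta>\<in>UNIV. (partial \<beta> (xc f) p * partial \<gamma> (xc f) p
                            + partial \<beta> (yc f) p * partial \<gamma> (yc f) p) * partial \<beta> \<phi> p)) = 0)"

definition harmonic_curve :: "(real^'n::finite) set \<Rightarrow> (real^'n \<Rightarrow> heisenberg) \<Rightarrow> bool" where
  "harmonic_curve \<Omega> f \<longleftrightarrow>
     C_on 2 \<Omega> f \<and> isotropic_map \<Omega> f \<and> contact_map \<Omega> f \<and> critical_map \<Omega> f"

end

theory Submission
  imports Defs
begin

text \<open>
  Integrating the criticality condition by parts, with \<open>E = |\<nabla>z|\<^sup>2\<close>, the second derivatives cancel
  in pairs by symmetry and the fundamental lemma of the calculus of variations leaves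
  \<open>\<Delta>x \<partial>\<^sub>\<gamma>x + \<Delta>y \<partial>\<^sub>\<gamma>y = 0\<close>. For \<open>x = H \<circ> y\<close> this says that
  \<open>(1 + H'\<^sup>2) \<Delta>y + H' H'' |\<nabla>y|\<^sup>2\<close> vanishes wherever \<open>\<nabla>y\<close> does not, and then everywhere by continuity.
  On the other hand \<open>u \<Delta>u + |\<nabla>u|\<^sup>2 = \<Delta>(u\<^sup>2) / 2 = |\<nabla>x|\<^sup>2 + |\<nabla>y|\<^sup>2 + x \<Delta>x + y \<Delta>y\<close>, and
  eliminating \<open>\<Delta>y\<close> turns this into
  \<open>(1 + H'\<^sup>2) |\<nabla>y|\<^sup>2 + H'' (H - y H') |\<nabla>y|\<^sup>2 / (1 + H'\<^sup>2)\<close>.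
\<close>

section \<open>Functions of class \<open>C\<^sup>k\<close> and partial derivatives\<close>

lemma frechet_derivative_eqI:
  "(f has_derivative D) (at p) \<Longrightarrow> frechet_derivative f (at p) = D"
  using frechet_derivative_at by metis

lemma C_on_has_derivative:
  "C_on (Suc k) S f \<Longrightarrow> p \<in> S \<Longrightarrow> (f has_derivative frechet_derivative f (at p)) (at p)"
  by (simp add: frechet_derivative_works)

text \<open>Openness of \<open>S\<close> makes derivatives at points of \<open>S\<close> depend only
  on values taken in \<open>S\<close>, so agreement on \<open>S\<close> is inherited by every
  directional derivative and the induction goes through.\<close>

lemma C_on_cong:
  assumes "open S" "\<And>p. p \<in> S \<Longrightarrow> f p = g p" "C_on k S f"
  shows "C_on k S g"
  using assms
proof (induction k arbitrary: f g)
  case 0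
  then show ?case by (metis C_on.simps(1) continuous_on_cong)
next
  case (Suc k)
  have D: "(g has_derivative frechet_derivative f (at p)) (at p)" if "p \<in> S" for p
    using has_derivative_transform_within_open[OF C_on_has_derivative[OF Suc.prems(3) that] \<open>open S\<close> that]
      Suc.prems(2) by blast
  have "C_on k S (\<lambda>p. frechet_derivative g (at p) v)" for v
    by (rule Suc.IH[OF \<open>open S\<close>, of "\<lambda>p. frechet_derivative f (at p) v"])
      (use Suc.prems frechet_derivative_eqI[OF D] in auto)
  with D show ?case by (auto simp: differentiable_def)
qed

text \<open>Replaces the choice-defined \<open>frechet_derivative\<close> by an explicit derivative
  \<open>D\<close>. The closure properties below all follow by induction on the order, with
  \<open>D\<close> read off from the matching differentiation rule.\<close>

lemma C_on_SucI:
  assumes "open S" "\<And>p. p \<in> S \<Longrightarrow> (f has_derivative D p) (at p)"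
    and "\<And>v. C_on k S (\<lambda>p. D p v)"
  shows "C_on (Suc k) S f"
proof -
  have "C_on k S (\<lambda>p. frechet_derivative f (at p) v)" for v
    by (rule C_on_cong[OF \<open>open S\<close> _ assms(3)[of v]])
      (simp add: frechet_derivative_eqI[OF assms(2)])
  with assms(2) show ?thesis by (auto simp: differentiable_def)
qed

lemma C_on_Suc_imp: "C_on (Suc k) S f \<Longrightarrow> C_on k S f"
proof (induction k arbitrary: f)
  case 0
  then show ?case
    by (auto intro!: continuous_at_imp_continuous_on differentiable_imp_continuous_within)
next
  case (Suc k)
  then show ?case by (metis C_on.simps(2))
qed

lemma C_on_imp_continuous_on: "C_on k S f \<Longrightarrow> continuous_on S f"
  by (induction k) (use C_on_Suc_imp in \<open>auto simp del: C_on.simps(2)\<close>)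

lemma C_on_subset: "C_on k S f \<Longrightarrow> T \<subseteq> S \<Longrightarrow> C_on k T f"
proof (induction k arbitrary: f)
  case 0
  then show ?case by (auto intro: continuous_on_subset)
next
  case (Suc k)
  then show ?case by (metis C_on.simps(2) subsetD)
qed

text \<open>Serves to glue a function on \<open>S\<close> to its extension by zero when integrating
  by parts.\<close>

lemma C_on_Un:
  assumes "open S" "open T" "C_on k S f" "C_on k T f"
  shows "C_on k (S \<union> T) f"
  using assms
proof (induction k arbitrary: f)
  case 0
  then show ?case by (auto intro: continuous_on_open_Un)
next
  case (Suc k)
  then show ?case by auto
qed

lemma C_on_const: "open S \<Longrightarrow> C_on k S (\<lambda>p. c)"
proof (induction k arbitrary: c)
  case (Suc k)
  show ?case by (rule C_on_SucI[where D="\<lambda>p v. 0"]) (use Suc in auto)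
qed auto

lemma C_on_bounded_linear:
  assumes "open S" "bounded_linear L" "C_on k S f"
  shows "C_on k S (\<lambda>p. L (f p))"
  using assms(3)
proof (induction k arbitrary: f)
  case 0
  then show ?case
    using assms(2) by (auto intro: bounded_linear.continuous_on)
next
  case (Suc k)
  show ?case
    by (rule C_on_SucI[OF \<open>open S\<close> bounded_linear.has_derivative[OF assms(2) C_on_has_derivative[OF Suc.prems]]])
      (use Suc in auto)
qed

lemma C_on_add:
  assumes "open S" "C_on k S f" "C_on k S g"
  shows "C_on k S (\<lambda>p. f p + g p)"
  using assms(2,3)
proof (induction k arbitrary: f g)
  case 0
  then show ?case by (auto intro: continuous_intros)
next
  case (Suc k)
  show ?case
    by (rule C_on_SucI[OF \<open>open S\<close> has_derivative_add[OF C_on_has_derivative[OF Suc.prems(1)]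
            C_on_has_derivative[OF Suc.prems(2)]]])
      (use Suc in auto)
qed

lemma C_on_mult:
  fixes f g :: "'a::real_normed_vector \<Rightarrow> 'b::real_normed_algebra"
  assumes "open S" "C_on k S f" "C_on k S g"
  shows "C_on k S (\<lambda>p. f p * g p)"
  using assms(2,3)
proof (induction k arbitrary: f g)
  case 0
  then show ?case by (auto intro: continuous_intros)
next
  case (Suc k)
  show ?case
  proof (rule C_on_SucI[OF \<open>open S\<close> has_derivative_mult[OF C_on_has_derivative[OF Suc.prems(1)]
            C_on_has_derivative[OF Suc.prems(2)]]])
    fix v
    show "C_on k S (\<lambda>p. f p * frechet_derivative g (at p) v + frechet_derivative f (at p) v * g p)"
      \<comment> \<open>The product rule mixes the functions with their derivatives, so
        \<open>f\<close> and \<open>g\<close> themselves are also needed at the lower order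
        \<open>k\<close>.\<close>
      using Suc.prems by (intro C_on_add[OF \<open>open S\<close>] Suc.IH) (auto intro: C_on_Suc_imp)
  qed
qed

lemma C_on_sum:
  assumes "open S" "finite A" "\<And>i. i \<in> A \<Longrightarrow> C_on k S (f i)"
  shows "C_on k S (\<lambda>p. \<Sum>i\<in>A. f i p)"
  using assms(2,3) by (induction A) (auto intro: C_on_add C_on_const assms(1))

section \<open>Calculus rules for partial derivatives\<close>

lemma C_on_partial: "C_on (Suc k) S g \<Longrightarrow> C_on k S (partial i g)"
  by (auto simp: partial_def[abs_def])

lemma partial_eqI: "(g has_derivative D) (at p) \<Longrightarrow> partial i g p = D (axis i 1)"
  by (simp add: partial_def frechet_derivative_eqI)

lemma partial_cong:
  assumes "open S" "p \<in> S" "\<And>q. q \<in> S \<Longrightarrow> f q = g q"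
    and "f differentiable (at p)"
  shows "partial i f p = partial i g p"
proof -
  have "(g has_derivative frechet_derivative f (at p)) (at p)"
    using has_derivative_transform_within_open[OF assms(4)[unfolded frechet_derivative_works] assms(1,2)]
      assms(3) by blast
  then show ?thesis by (simp add: partial_def frechet_derivative_eqI)
qed

lemma partial_const: "partial i (\<lambda>q. c) p = 0"
  by (simp add: partial_def)

lemma partial_add:
  "f differentiable (at p) \<Longrightarrow> g differentiable (at p) \<Longrightarrow>
    partial i (\<lambda>q. f q + g q) p = partial i f p + partial i g p"
  by (subst partial_eqI[OF has_derivative_add]) (auto simp: frechet_derivative_works partial_def)

lemma partial_mult:
  "f differentiable (at p) \<Longrightarrow> g differentiable (at p) \<Longrightarrow>
    partial i (\<lambda>q. f q * g q) p = f p * partial i g p + partial i f p * g p"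
  by (subst partial_eqI[OF has_derivative_mult]) (auto simp: frechet_derivative_works partial_def)

lemma partial_sum:
  "finite A \<Longrightarrow> (\<And>j. j \<in> A \<Longrightarrow> f j differentiable (at p)) \<Longrightarrow>
    partial i (\<lambda>q. \<Sum>j\<in>A. f j q) p = (\<Sum>j\<in>A. partial i (f j) p)"
  by (subst partial_eqI[OF has_derivative_sum]) (auto simp: frechet_derivative_works partial_def)

section \<open>Symmetry of second derivatives\<close>

lemma has_derivative_along_line:
  assumes "(G has_derivative G') (at (p + u *\<^sub>R v))"
  shows "((\<lambda>u. G (p + u *\<^sub>R v)) has_derivative (\<lambda>r. r *\<^sub>R G' v)) (at u)"
proof -
  have "((\<lambda>u. p + u *\<^sub>R v) has_derivative (\<lambda>r. r *\<^sub>R v)) (at u)"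
    by (auto intro!: derivative_eq_intros)
  from has_derivative_compose[OF this assms] show ?thesis
    using linear_cmul[OF has_derivative_linear[OF assms]] by simp
qed

text \<open>Both orders of differentiation compute the same second difference quotient.\<close>

lemma second_difference_mvt:
  fixes g :: "'a::real_normed_vector \<Rightarrow> real"
  assumes "C_on 2 S g" "open S" "cball p (s * (norm a + norm b)) \<subseteq> S" "0 < s"
  shows "\<exists>q\<in>cball p (s * (norm a + norm b)).
    g (p + s *\<^sub>R a + s *\<^sub>R b) - g (p + s *\<^sub>R a) - g (p + s *\<^sub>R b) + g p
      = s * s * frechet_derivative (\<lambda>p. frechet_derivative g (at p) a) (at q) b"
proof -
  \<comment> \<open>Every point at which \<open>g\<close> is evaluated or differentiated lies in the
    parallelogram spanned at \<open>p\<close> by \<open>s *\<^sub>R a\<close> and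
    \<open>s *\<^sub>R b\<close>, hence in the given ball.\<close>
  have in_ball: "p + u *\<^sub>R a + w *\<^sub>R b \<in> cball p (s * (norm a + norm b))"
    if "0 \<le> u" "u \<le> s" "0 \<le> w" "w \<le> s" for u w
  proof -
    have "norm (u *\<^sub>R a + w *\<^sub>R b) \<le> u * norm a + w * norm b"
      using that by (metis abs_of_nonneg norm_scaleR norm_triangle_ineq)
    also have "\<dots> \<le> s * norm a + s * norm b"
      using that by (intro add_mono mult_right_mono) auto
    finally show ?thesis
      by (simp add: dist_norm algebra_simps norm_minus_commute)
  qed
  have C: "C_on (Suc 1) S g" using assms(1) by (simp add: numeral_2_eq_2)
  have D1: "(g has_derivative frechet_derivative g (at q)) (at q)" if "q \<in> S" for q
    using C that C_on_has_derivative by blast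
  have "C_on (Suc 0) S (\<lambda>q. frechet_derivative g (at q) a)" using C by auto
  note D2 = C_on_has_derivative[OF this]
  define F where "F q = frechet_derivative g (at q) a" for q
  \<comment> \<open>\<open>\<phi> u\<close> is the first difference in direction \<open>b\<close>,
    based at \<open>p + u *\<^sub>R a\<close>, so the second difference is
    \<open>\<phi> s - \<phi> 0\<close>. The mean value theorem in \<open>u\<close> turns it into an
    increment of \<open>F\<close> along \<open>b\<close>; a second application, to
    \<open>\<psi>\<close>, produces the mixed derivative.\<close>
  define \<phi> where "\<phi> u = g (p + s *\<^sub>R b + u *\<^sub>R a) - g (p + u *\<^sub>R a)" for u
  define \<phi>' where "\<phi>' u r = r *\<^sub>R F (p + s *\<^sub>R b + u *\<^sub>R a) - r *\<^sub>R F (p + u *\<^sub>R a)" for u r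
  have d\<phi>: "(\<phi> has_derivative \<phi>' u) (at u within {0..s})" if "u \<in> {0..s}" for u
  proof -
    have i: "p + s *\<^sub>R b + u *\<^sub>R a \<in> S" "p + u *\<^sub>R a \<in> S"
      using in_ball[of u s] in_ball[of u 0] that assms(3,4) by (auto simp: algebra_simps)
    show ?thesis unfolding \<phi>_def[abs_def] \<phi>'_def[abs_def] F_def
      by (rule has_derivative_at_withinI, rule has_derivative_diff[OF has_derivative_along_line[OF D1[OF i(1)]] has_derivative_along_line[OF D1[OF i(2)]]])
  qed
  obtain u where u: "u \<in> {0<..<s}" and e1: "\<phi> s - \<phi> 0 = \<phi>' u (s - 0)"
    using mvt_simple[OF \<open>0 < s\<close> d\<phi>] by (metis atLeastAtMost_iff)
  define \<psi> where "\<psi> w = F (p + u *\<^sub>R a + w *\<^sub>R b)" for w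
  define \<psi>' where "\<psi>' w r = r *\<^sub>R frechet_derivative F (at (p + u *\<^sub>R a + w *\<^sub>R b)) b" for w r
  have d\<psi>: "(\<psi> has_derivative \<psi>' w) (at w within {0..s})" if "w \<in> {0..s}" for w
  proof -
    have i: "p + u *\<^sub>R a + w *\<^sub>R b \<in> S"
      using in_ball[of u w] u that assms(3) by auto
    show ?thesis unfolding \<psi>_def[abs_def] \<psi>'_def[abs_def]
      by (rule has_derivative_at_withinI, unfold F_def[abs_def], rule has_derivative_along_line[OF D2[OF i]])
  qed
  obtain w where w: "w \<in> {0<..<s}" and e2: "\<psi> s - \<psi> 0 = \<psi>' w (s - 0)"
    using mvt_simple[OF \<open>0 < s\<close> d\<psi>] by (metis atLeastAtMost_iff)
  have "g (p + s *\<^sub>R a + s *\<^sub>R b) - g (p + s *\<^sub>R a) - g (p + s *\<^sub>R b) + g p = \<phi> s - \<phi> 0"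
    by (simp add: \<phi>_def algebra_simps)
  also have "\<dots> = s * (\<psi> s - \<psi> 0)"
    unfolding e1 by (simp add: \<phi>'_def \<psi>_def algebra_simps)
  also have "\<dots> = s * s * frechet_derivative F (at (p + u *\<^sub>R a + w *\<^sub>R b)) b"
    unfolding e2 by (simp add: \<psi>'_def)
  finally show ?thesis
    using in_ball[of u w] u w unfolding F_def[abs_def] by auto
qed

text \<open>The second difference is symmetric in \<open>a\<close> and \<open>b\<close>, so the two
  mixed derivatives agree at two possibly different points near \<open>p\<close>. Both points tend
  to \<open>p\<close> as the step shrinks, and continuity of the second derivatives gives equality
  there.\<close>

lemma frechet_derivative_commute:
  fixes g :: "'a::real_normed_vector \<Rightarrow> real"
  assumes "C_on 2 S g" "open S" "p \<in> S"
  shows "frechet_derivative (\<lambda>p. frechet_derivative g (at p) a) (at p) b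
    = frechet_derivative (\<lambda>p. frechet_derivative g (at p) b) (at p) a"
proof -
  define F where "F a b q = frechet_derivative (\<lambda>p. frechet_derivative g (at p) a) (at q) b" for a b q
  \<comment> \<open>Radius of the ball that \<open>second_difference_mvt\<close> requires for the
    step \<open>inverse (real (Suc n))\<close>.\<close>
  define \<epsilon> where "\<epsilon> n = inverse (real (Suc n)) * (norm a + norm b)" for n
  have cont: "isCont (F a b) p" for a b
  proof -
    have "C_on (Suc (Suc 0)) S g" using assms(1) by (simp only: numeral_2_eq_2)
    then have "continuous_on S (F a b)"
      unfolding F_def[abs_def] C_on.simps by blast
    then show ?thesis using assms(2,3) by (simp add: continuous_on_eq_continuous_at)
  qed
  have \<epsilon>0: "\<epsilon> \<longlonglongrightarrow> 0"
    unfolding \<epsilon>_def by (rule tendsto_mult_left_zero[OF LIMSEQ_inverse_real_of_nat])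
  obtain r where r: "r > 0" "cball p r \<subseteq> S"
    using assms(2,3) open_contains_cball by blast
  have "\<forall>\<^sub>F n in sequentially. \<epsilon> n < r"
    using order_tendstoD(2)[OF \<epsilon>0 r(1)] .
  then obtain N where N: "\<And>n. n \<ge> N \<Longrightarrow> \<epsilon> n < r" by (auto simp: eventually_sequentially)
  have "\<exists>q q'. dist p q \<le> \<epsilon> n \<and> dist p q' \<le> \<epsilon> n \<and> F a b q = F b a q'" if "n \<ge> N" for n
  proof -
    define s where "s = inverse (real (Suc n))"
    have s: "0 < s" by (simp add: s_def)
    have \<epsilon>s: "\<epsilon> n = s * (norm a + norm b)" "\<epsilon> n = s * (norm b + norm a)"
      by (simp_all add: \<epsilon>_def s_def add.commute)
    have ball: "cball p (\<epsilon> n) \<subseteq> S"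
      using N[OF that] r(2) by auto
    obtain q where q: "q \<in> cball p (\<epsilon> n)"
      "g (p + s *\<^sub>R a + s *\<^sub>R b) - g (p + s *\<^sub>R a) - g (p + s *\<^sub>R b) + g p = s * s * F a b q"
      using second_difference_mvt[OF assms(1,2) ball[unfolded \<epsilon>s(1)] s] unfolding F_def \<epsilon>s(1) by blast
    obtain q' where q': "q' \<in> cball p (\<epsilon> n)"
      "g (p + s *\<^sub>R b + s *\<^sub>R a) - g (p + s *\<^sub>R b) - g (p + s *\<^sub>R a) + g p = s * s * F b a q'"
      using second_difference_mvt[OF assms(1,2) ball[unfolded \<epsilon>s(2)] s] unfolding F_def \<epsilon>s(2) by blast
    have "p + s *\<^sub>R b + s *\<^sub>R a = p + s *\<^sub>R a + s *\<^sub>R b" by simp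
    then have "s * s * F a b q = s * s * F b a q'"
      using q(2) q'(2) by (simp only:)
    then have "F a b q = F b a q'" using s by simp
    with q(1) q'(1) show ?thesis by auto
  qed
  \<comment> \<open>The condition \<open>n \<ge> N\<close> moves inside the quantifiers so that
    choice yields sequences defined for every \<open>n\<close>.\<close>
  then have "\<forall>n. \<exists>q q'. n \<ge> N \<longrightarrow> dist p q \<le> \<epsilon> n \<and> dist p q' \<le> \<epsilon> n \<and> F a b q = F b a q'"
    by blast
  then obtain q q' where *: "\<And>n. n \<ge> N \<Longrightarrow>
      dist p (q n) \<le> \<epsilon> n \<and> dist p (q' n) \<le> \<epsilon> n \<and> F a b (q n) = F b a (q' n)"
    unfolding choice_iff by blast
  have q: "dist p (q n) \<le> \<epsilon> n" and q': "dist p (q' n) \<le> \<epsilon> n" and eq: "F a b (q n) = F b a (q' n)"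
    if "n \<ge> N" for n using *[OF that] by auto
  have lim: "x \<longlonglongrightarrow> p" if "\<And>n. n \<ge> N \<Longrightarrow> dist p (x n) \<le> \<epsilon> n" for x
  proof (rule metric_tendsto_imp_tendsto[OF \<epsilon>0])
    show "\<forall>\<^sub>F n in sequentially. dist (x n) p \<le> dist (\<epsilon> n) 0"
      using that by (auto simp: eventually_sequentially dist_commute intro: order_trans[OF _ abs_ge_self])
  qed
  have "(\<lambda>n. F a b (q n)) \<longlonglongrightarrow> F a b p"
    using isCont_tendsto_compose[OF cont lim] q by blast
  moreover have "(\<lambda>n. F a b (q n)) \<longlonglongrightarrow> F b a p"
  proof (rule Lim_transform_eventually)
    show "(\<lambda>n. F b a (q' n)) \<longlonglongrightarrow> F b a p"
      using isCont_tendsto_compose[OF cont lim] q' by blast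
  qed (auto simp: eventually_sequentially eq intro!: exI[of _ N])
  ultimately show ?thesis unfolding F_def using LIMSEQ_unique by blast
qed

lemma partial_commute:
  "C_on 2 S g \<Longrightarrow> open S \<Longrightarrow> p \<in> S \<Longrightarrow>
    partial i (partial j g) p = partial j (partial i g) p"
  unfolding partial_def[abs_def] by (rule frechet_derivative_commute)

section \<open>Integration by parts\<close>

lemma compact_support_integrable:
  fixes h :: "'a::euclidean_space \<Rightarrow> real"
  assumes "compact K" "continuous_on K h" "\<And>x. x \<notin> K \<Longrightarrow> h x = 0"
  shows "integrable lborel h"
proof -
  have "(\<lambda>x. indicator K x *\<^sub>R h x) = h"
    using assms(3) by (intro ext) (auto simp: indicator_def)
  with borel_integrable_compact[OF assms(1,2)] show ?thesis by simp
qed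

lemma partial_eq_0_outside:
  assumes "closed K" "\<And>x. x \<notin> K \<Longrightarrow> h x = 0" "x \<notin> K"
  shows "partial i h x = 0"
proof -
  have "partial i (\<lambda>x. 0) x = partial i h x"
    by (rule partial_cong[of "- K"]) (use assms in auto)
  then show ?thesis
    by (simp add: partial_const)
qed

lemma integral_translation_lborel:
  fixes h :: "'a::euclidean_space \<Rightarrow> real"
  assumes "integrable lborel h"
  shows "integrable lborel (\<lambda>x. h (x + c))" "integral\<^sup>L lborel (\<lambda>x. h (x + c)) = integral\<^sup>L lborel h"
proof -
  have "(\<lambda>x. x + c) = (+) c" by (simp add: fun_eq_iff add.commute)
  then have d: "distr lborel borel (\<lambda>x. x + c) = lborel"
    by (simp add: lborel_distr_plus)
  have m: "h \<in> borel_measurable borel"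
    using assms by auto
  show "integrable lborel (\<lambda>x. h (x + c))"
    using assms integrable_distr_eq[of "\<lambda>x. x + c" lborel borel h] d m by simp
  show "integral\<^sup>L lborel (\<lambda>x. h (x + c)) = integral\<^sup>L lborel h"
    using integral_distr[of "\<lambda>x. x + c" lborel borel h] d m by simp
qed

text \<open>The difference quotients have integral zero by translation invariance, and converge
  boundedly to the derivative.\<close>

lemma integral_partial_eq_0:
  fixes h :: "real^'n::finite \<Rightarrow> real"
  assumes C: "C_on 1 UNIV h" and K: "compact K" and out: "\<And>x. x \<notin> K \<Longrightarrow> h x = 0"
  shows "integral\<^sup>L lborel (partial i h) = 0"
proof -
  let ?e = "axis i 1 :: real^'n"
  have C1: "C_on (Suc 0) UNIV h" using C by simp
  have cont: "continuous_on UNIV h" "continuous_on UNIV (partial i h)"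
    using C_on_imp_continuous_on[OF C] C_on_partial[OF C1, of i] by simp_all
  have p_out: "partial i h x = 0" if "x \<notin> K" for x
    using partial_eq_0_outside[OF compact_imp_closed[OF K] out that] .
  have int_h: "integrable lborel h"
    by (rule compact_support_integrable[OF K continuous_on_subset[OF cont(1)] out]) auto
  obtain M where M: "\<And>x. x \<in> K \<Longrightarrow> \<bar>partial i h x\<bar> \<le> M"
    using compact_imp_bounded[OF compact_continuous_image[OF continuous_on_subset[OF cont(2)] K]]
    by (auto simp: bounded_iff)
  \<comment> \<open>The absolute value of \<open>M\<close> is taken because \<open>M\<close> bounds
    values on \<open>K\<close> only and could be negative if \<open>K\<close> is empty.\<close>
  have bnd: "\<bar>partial i h x\<bar> \<le> \<bar>M\<bar>" for x
    using M[of x] p_out[of x] by (cases "x \<in> K") auto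
  obtain R where R: "\<And>x. x \<in> K \<Longrightarrow> norm x \<le> R"
    using compact_imp_bounded[OF K] by (auto simp: bounded_iff)
  have line: "((\<lambda>u. h (x + u *\<^sub>R ?e)) has_derivative (\<lambda>r. r * partial i h (x + u *\<^sub>R ?e))) (at u)" for x u
    using has_derivative_along_line[OF C_on_has_derivative[OF C1, of "x + u *\<^sub>R ?e"]]
    by (simp add: partial_def)
  define t where "t n = inverse (real (Suc n))" for n
  have t: "0 < t n" "t n \<le> 1" for n by (auto simp: t_def inverse_le_1_iff)
  define d where "d n x = (h (x + t n *\<^sub>R ?e) - h x) / t n" for n x
  \<comment> \<open>Integrable majorant: a step of length at most 1 moves the support out of the
    ball of radius \<open>R\<close> by at most 1, and inside the larger ball the mean value theorem
    bounds the quotient.\<close>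
  have d_bound: "\<bar>d n x\<bar> \<le> \<bar>M\<bar> * indicator (cball 0 (R + 1)) x" for n x
  proof (cases "norm x \<le> R + 1")
    case True
    have "\<exists>u\<in>{0<..<t n}. h (x + t n *\<^sub>R ?e) - h (x + 0 *\<^sub>R ?e) = (t n - 0) * partial i h (x + u *\<^sub>R ?e)"
      by (rule mvt_simple[OF t(1)]) (rule has_derivative_at_withinI[OF line])
    then obtain u where "h (x + t n *\<^sub>R ?e) - h x = t n * partial i h (x + u *\<^sub>R ?e)"
      by auto
    then have "d n x = partial i h (x + u *\<^sub>R ?e)"
      using t(1)[of n] by (simp add: d_def)
    then show ?thesis using bnd True by simp
  next
    case False
    have "norm x \<le> norm (x + t n *\<^sub>R ?e) + norm (t n *\<^sub>R ?e)"
      using norm_triangle_ineq4[of "x + t n *\<^sub>R ?e" "t n *\<^sub>R ?e"] by simp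
    moreover have "norm (t n *\<^sub>R ?e) \<le> 1" using t[of n] by simp
    ultimately have "\<not> norm (x + t n *\<^sub>R ?e) \<le> R" "\<not> norm x \<le> R" using False by auto
    then have "h (x + t n *\<^sub>R ?e) = 0" "h x = 0" using R out by blast+
    then show ?thesis by (simp add: d_def)
  qed
  have d_lim: "(\<lambda>n. d n x) \<longlonglongrightarrow> partial i h x" for x
  proof -
    have "((\<lambda>u. h (x + u *\<^sub>R ?e)) has_real_derivative partial i h x) (at 0)"
      using line[of x 0] by (auto simp: has_field_derivative_def elim!: has_derivative_eq_rhs)
    then have "((\<lambda>u. (h (x + u *\<^sub>R ?e) - h x) / u) \<longlongrightarrow> partial i h x) (at 0)"
      by (simp add: DERIV_def)
    moreover have "filterlim t (at 0) sequentially"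
      using LIMSEQ_inverse_real_of_nat t(1) less_imp_neq[OF t(1)]
      by (auto simp: t_def[abs_def] intro!: filterlim_atI)
    ultimately show ?thesis
      unfolding d_def by (rule filterlim_compose)
  qed
  have "(\<lambda>n. integral\<^sup>L lborel (d n)) \<longlonglongrightarrow> integral\<^sup>L lborel (partial i h)"
  proof (rule integral_dominated_convergence[where w="\<lambda>x. \<bar>M\<bar> * indicator (cball 0 (R + 1)) x"])
    show "partial i h \<in> borel_measurable lborel"
      using borel_measurable_continuous_onI[OF cont(2)] by simp
    show "d n \<in> borel_measurable lborel" for n
      unfolding d_def using borel_measurable_integrable[OF int_h] by measurable
    show "integrable lborel (\<lambda>x::real^'n. \<bar>M\<bar> * indicator (cball 0 (R + 1)) x :: real)"
      using emeasure_bounded_finite[OF bounded_cball[of "0::real^'n" "R + 1"]]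
      by (intro integrable_mult_right integrable_real_indicator) auto
  qed (use d_lim d_bound in auto)
  moreover have "integral\<^sup>L lborel (d n) = 0" for n
    unfolding d_def using integral_translation_lborel[OF int_h] int_h by simp
  ultimately show ?thesis by (simp add: LIMSEQ_const_iff)
qed

lemma test_function_C_on: "test_function S \<phi> \<Longrightarrow> C_on k UNIV \<phi>"
  by (simp add: test_function_def)

lemma test_function_outside:
  "test_function S \<phi> \<Longrightarrow> x \<notin> closure {p. \<phi> p \<noteq> 0} \<Longrightarrow> \<phi> x = 0"
  using closure_subset[of "{p. \<phi> p \<noteq> 0}"] by auto

lemma test_function_partial_outside:
  "test_function S \<phi> \<Longrightarrow> x \<notin> closure {p. \<phi> p \<noteq> 0} \<Longrightarrow> partial i \<phi> x = 0"
  using partial_eq_0_outside[of "closure {p. \<phi> p \<noteq> 0}" \<phi> x i] test_function_outside by blast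

lemma test_function_differentiable: "test_function S \<phi> \<Longrightarrow> \<phi> differentiable (at x)"
  using test_function_C_on[of S \<phi> "Suc 0"] by simp

text \<open>On \<open>K\<close> the indicator of \<open>S\<close> equals 1, so the integrand is
  continuous on a compact set and zero off it. The coefficient \<open>a\<close> may be unbounded
  near the boundary of \<open>S\<close>.\<close>

lemma set_integrable_mult_compact_support:
  fixes a \<psi> :: "'a::euclidean_space \<Rightarrow> real"
  assumes "continuous_on S a" "continuous_on UNIV \<psi>" "compact K" "K \<subseteq> S"
    "\<And>x. x \<notin> K \<Longrightarrow> \<psi> x = 0"
  shows "set_integrable lborel S (\<lambda>p. a p * \<psi> p)"
  unfolding set_integrable_def
proof (rule compact_support_integrable[OF assms(3)])
  have "continuous_on K (\<lambda>p. a p * \<psi> p)"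
    using assms(4) by (intro continuous_on_mult continuous_on_subset[OF assms(1)] continuous_on_subset[OF assms(2)]) auto
  then show "continuous_on K (\<lambda>p. indicator S p *\<^sub>R (a p * \<psi> p))"
    using assms(4) by (subst continuous_on_cong[of _ K _ "\<lambda>p. a p * \<psi> p"]) auto
qed (use assms in auto)

lemma set_integrable_mult_test_function:
  assumes "continuous_on S a" "test_function S \<phi>"
  shows "set_integrable lborel S (\<lambda>p. a p * \<phi> p)"
    and "set_integrable lborel S (\<lambda>p. a p * partial i \<phi> p)"
proof -
  have K: "compact (closure {p. \<phi> p \<noteq> 0})" "closure {p. \<phi> p \<noteq> 0} \<subseteq> S"
    using assms(2) by (auto simp: test_function_def)
  have c: "continuous_on UNIV \<phi>" "continuous_on UNIV (partial i \<phi>)"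
    using test_function_C_on[OF assms(2)] C_on_partial[of 0 UNIV \<phi>] C_on_imp_continuous_on[of 0]
    by (auto simp del: C_on.simps)
  show "set_integrable lborel S (\<lambda>p. a p * \<phi> p)"
    by (rule set_integrable_mult_compact_support[OF assms(1) c(1) K test_function_outside[OF assms(2)]])
  show "set_integrable lborel S (\<lambda>p. a p * partial i \<phi> p)"
    by (rule set_integrable_mult_compact_support[OF assms(1) c(2) K test_function_partial_outside[OF assms(2)]])
qed

text \<open>The product of \<open>g\<close> and \<open>\<phi>\<close>, extended by zero outside
  \<open>S\<close>, is continuously differentiable on \<open>S\<close> and on the complement of the
  support of \<open>\<phi>\<close>. These open sets cover the space, so the partial derivative of
  the extension has integral zero, and the product rule splits it.\<close>

lemma integration_by_parts_test_function:
  fixes g :: "real^'n::finite \<Rightarrow> real"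
  assumes S: "open S" and g: "C_on 1 S g" and \<phi>: "test_function S \<phi>"
  shows "(LINT p:S|lborel. g p * partial i \<phi> p) = - (LINT p:S|lborel. partial i g p * \<phi> p)"
proof -
  define K where "K = closure {p. \<phi> p \<noteq> 0}"
  have K: "compact K" "closed K" "K \<subseteq> S" using \<phi> by (auto simp: test_function_def K_def)
  have out: "\<phi> x = 0" if "x \<notin> K" for x
    using test_function_outside[OF \<phi>, of x] that unfolding K_def by blast
  have g1: "C_on (Suc 0) S g" using g by simp
  have gd: "g differentiable (at p)" if "p \<in> S" for p using g1 that by simp
  define h where "h p = (if p \<in> S then g p * \<phi> p else 0)" for p
  have \<phi>S: "C_on 1 S \<phi>"
    using test_function_C_on[OF \<phi>] by (rule C_on_subset) simp
  have "C_on 1 S h"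
    by (rule C_on_cong[OF S _ C_on_mult[OF S g \<phi>S]]) (simp add: h_def)
  moreover have "C_on 1 (- K) h"
    by (rule C_on_cong[OF _ _ C_on_const[where c=0]]) (use K out in \<open>auto simp: h_def\<close>)
  ultimately have "C_on 1 (S \<union> - K) h"
    using S K(2) by (intro C_on_Un) auto
  moreover have "S \<union> - K = UNIV" using K(3) by auto
  ultimately have "C_on 1 UNIV h" by simp
  then have "integral\<^sup>L lborel (partial i h) = 0"
    by (rule integral_partial_eq_0[OF _ K(1)]) (simp add: h_def out)
  also have "partial i h = (\<lambda>p. indicator S p *\<^sub>R (g p * partial i \<phi> p + partial i g p * \<phi> p))"
  proof
    fix p
    show "partial i h p = indicator S p *\<^sub>R (g p * partial i \<phi> p + partial i g p * \<phi> p)"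
    proof (cases "p \<in> S")
      case True
      have "partial i (\<lambda>p. g p * \<phi> p) p = partial i h p"
        by (rule partial_cong[OF S True])
          (use gd[OF True] test_function_differentiable[OF \<phi>] in \<open>auto simp: h_def\<close>)
      then show ?thesis
        using True partial_mult[OF gd[OF True] test_function_differentiable[OF \<phi>]] by simp
    next
      case False
      then have "p \<notin> K" using K by auto
      have "partial i h p = 0"
        by (rule partial_eq_0_outside[OF K(2) _ \<open>p \<notin> K\<close>]) (simp add: h_def out)
      with False show ?thesis by simp
    qed
  qed
  finally have "(LINT p:S|lborel. g p * partial i \<phi> p + partial i g p * \<phi> p) = 0"
    by (simp add: set_lebesgue_integral_def)
  moreover have "continuous_on S g" "continuous_on S (partial i g)"
    using C_on_imp_continuous_on[OF g] C_on_partial[OF g1] by auto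
  ultimately show ?thesis
    using set_integrable_mult_test_function[OF _ \<phi>] by (subst (asm) set_integral_add) auto
qed

section \<open>Bump functions and the fundamental lemma\<close>

text \<open>For \<open>m = 0\<close> this is the classical smooth function that vanishes to infinite
  order at 0. The powers of \<open>inverse s\<close> make the family closed under differentiation up
  to linear combinations.\<close>

definition flat :: "nat \<Rightarrow> real \<Rightarrow> real" where
  "flat m s = (if s > 0 then inverse s ^ m * exp (- inverse s) else 0)"

lemma has_derivative_flat:
  "(flat m has_real_derivative (flat (m + 2) s - real m * flat (Suc m) s)) (at s)"
proof -
  consider "s < 0" | "s > 0" | "s = 0" by linarith
  then show ?thesis
  proof cases
    case 1
    have "((\<lambda>s. 0) has_real_derivative (flat (m + 2) s - real m * flat (Suc m) s)) (at s)"
      using 1 by (simp add: flat_def)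
    then show ?thesis
      by (rule has_field_derivative_transform_within_open[of _ _ _ "{..<0}"])
        (use 1 in \<open>auto simp: flat_def\<close>)
  next
    case 2
    have "((\<lambda>s. inverse s ^ m * exp (- inverse s)) has_real_derivative
       (flat (m + 2) s - real m * flat (Suc m) s)) (at s)"
    proof -
      have "((\<lambda>s. inverse s ^ m) has_real_derivative - real m * inverse s ^ Suc m) (at s)"
        using DERIV_power[OF DERIV_inverse[of s], of m] 2 by (cases m) (auto simp: algebra_simps)
      moreover have "((\<lambda>s. exp (- inverse s)) has_real_derivative exp (- inverse s) * inverse s ^ 2) (at s)"
        using 2 by (auto intro!: derivative_eq_intros simp: power2_eq_square)
      ultimately show ?thesis
        using DERIV_mult 2 by (fastforce simp: flat_def power2_eq_square algebra_simps)
    qed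
    then show ?thesis
      by (rule has_field_derivative_transform_within_open[of _ _ _ "{0<..}"])
        (use 2 in \<open>auto simp: flat_def\<close>)
  next
    case 3
    \<comment> \<open>At 0 the right difference quotient is
      \<open>inverse u ^ Suc m * exp (- inverse u)\<close>, which tends to 0 because the exponential
      beats every power as \<open>inverse u\<close> grows. The left quotient is identically
      0.\<close>
    have "((\<lambda>u. flat m u / u) \<longlongrightarrow> 0) (at_right 0)"
    proof (rule Lim_transform_eventually)
      show "((\<lambda>u. inverse u ^ Suc m / exp (inverse u)) \<longlongrightarrow> (0::real)) (at_right 0)"
        by (rule filterlim_compose[OF tendsto_power_div_exp_0 filterlim_inverse_at_top_right])
      show "\<forall>\<^sub>F u in at_right 0. inverse u ^ Suc m / exp (inverse u) = flat m u / u"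
        using eventually_at_right_less[of 0]
        by eventually_elim (simp add: flat_def exp_minus divide_inverse)
    qed
    moreover have "((\<lambda>u. flat m u / u) \<longlongrightarrow> 0) (at_left 0)"
      by (rule tendsto_eventually) (auto simp: eventually_at_filter flat_def intro!: always_eventually)
    ultimately have "((\<lambda>u. flat m u / u) \<longlongrightarrow> 0) (at 0)"
      by (simp add: filterlim_split_at)
    then show ?thesis
      using 3 by (simp add: DERIV_def flat_def)
  qed
qed

text \<open>Smoothness of the bump function is proved for the whole algebra it generates, since that algebra
  is closed under directional derivatives.\<close>

inductive bump_algebra :: "'a::real_inner \<Rightarrow> real \<Rightarrow> ('a \<Rightarrow> real) \<Rightarrow> bool" for a r where
  const: "bump_algebra a r (\<lambda>x. c)"
| linear: "bounded_linear L \<Longrightarrow> bump_algebra a r L"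
| add: "bump_algebra a r f \<Longrightarrow> bump_algebra a r g \<Longrightarrow> bump_algebra a r (\<lambda>x. f x + g x)"
| mult: "bump_algebra a r f \<Longrightarrow> bump_algebra a r g \<Longrightarrow> bump_algebra a r (\<lambda>x. f x * g x)"
| flat: "bump_algebra a r (\<lambda>x. flat m (r\<^sup>2 - (x - a) \<bullet> (x - a)))"

lemma bump_algebra_derivative:
  "bump_algebra a r f \<Longrightarrow>
    \<exists>D. (\<forall>x. (f has_derivative D x) (at x)) \<and> (\<forall>v. bump_algebra a r (\<lambda>x. D x v))"
proof (induction rule: bump_algebra.induct)
  case (const c)
  show ?case
    by (rule exI[of _ "\<lambda>x v. 0"]) (auto intro: bump_algebra.const)
next
  case (linear L)
  then show ?case
    by (intro exI[of _ "\<lambda>x. L"]) (auto intro: bump_algebra.const bounded_linear_imp_has_derivative)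
next
  case (add f g)
  then obtain D E where "\<And>x. (f has_derivative D x) (at x)" "\<And>v. bump_algebra a r (\<lambda>x. D x v)"
    "\<And>x. (g has_derivative E x) (at x)" "\<And>v. bump_algebra a r (\<lambda>x. E x v)" by metis
  then show ?case
    by (intro exI[of _ "\<lambda>x v. D x v + E x v"]) (auto intro: bump_algebra.add has_derivative_add)
next
  case (mult f g)
  then obtain D E where "\<And>x. (f has_derivative D x) (at x)" "\<And>v. bump_algebra a r (\<lambda>x. D x v)"
    "\<And>x. (g has_derivative E x) (at x)" "\<And>v. bump_algebra a r (\<lambda>x. E x v)" by metis
  then show ?case
    using mult.hyps
    by (intro exI[of _ "\<lambda>x v. f x * E x v + D x v * g x"])
      (auto intro!: bump_algebra.add bump_algebra.mult has_derivative_mult)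
next
  case (flat m)
  let ?w = "\<lambda>x. r\<^sup>2 - (x - a) \<bullet> (x - a)"
  \<comment> \<open>The derivative of \<open>?w\<close>, that is
    \<open>-2 * ((x - a) \<bullet> v)\<close>, is expanded so that for fixed \<open>v\<close> it is
    visibly a linear function of \<open>x\<close> plus a constant, matching the constructors of the
    algebra.\<close>
  let ?W = "\<lambda>x v. (-2) * (x \<bullet> v) + 2 * (a \<bullet> v)"
  let ?D = "\<lambda>x v. ?W x v * (flat (m + 2) (?w x) + (- real m) * flat (Suc m) (?w x))"
  have "((\<lambda>x. flat m (?w x)) has_derivative ?D x) (at x)" for x
  proof -
    have "(?w has_derivative ?W x) (at x)"
      by (auto intro!: derivative_eq_intros simp: algebra_simps inner_commute)
    from has_derivative_compose[OF this has_derivative_flat[unfolded has_field_derivative_def]]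
    show ?thesis by (simp add: mult.commute)
  qed
  moreover have "bump_algebra a r (\<lambda>x. ?D x v)" for v
    by (intro bump_algebra.mult bump_algebra.add bump_algebra.const bump_algebra.flat
        bump_algebra.linear bounded_linear_inner_left)
  ultimately show ?case by (intro exI[of _ ?D]) auto
qed

lemma bump_algebra_C_on: "bump_algebra a r f \<Longrightarrow> C_on k UNIV f"
proof (induction k arbitrary: f)
  case 0
  then obtain D where "\<And>x. (f has_derivative D x) (at x)" using bump_algebra_derivative by blast
  then show ?case
    by (auto intro!: continuous_at_imp_continuous_on has_derivative_continuous)
next
  case (Suc k)
  from bump_algebra_derivative[OF Suc.prems] obtain D
    where "\<And>x. (f has_derivative D x) (at x)" "\<And>v. bump_algebra a r (\<lambda>x. D x v)" by blast
  then show ?case by (intro C_on_SucI[of UNIV f D] Suc.IH) auto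
qed

lemma exists_bump_function:
  fixes a :: "'a::euclidean_space"
  assumes "0 < r" "cball a r \<subseteq> S"
  obtains \<phi> where "test_function S \<phi>" "\<And>x. 0 \<le> \<phi> x" "\<And>x. \<phi> x > 0 \<longleftrightarrow> x \<in> ball a r"
proof
  \<comment> \<open>The squared distance is used because it is smooth at the centre \<open>a\<close>
    as well, unlike the distance itself.\<close>
  let ?\<phi> = "\<lambda>x. flat 0 (r\<^sup>2 - (x - a) \<bullet> (x - a))"
  show nonneg: "0 \<le> ?\<phi> x" for x by (simp add: flat_def)
  have "r\<^sup>2 - (x - a) \<bullet> (x - a) > 0 \<longleftrightarrow> x \<in> ball a r" for x
    using assms(1) power_strict_mono[of "dist a x" r 2] power2_less_imp_less[of "dist a x" r]
    by (auto simp: dot_square_norm dist_norm norm_minus_commute)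
  then show pos: "?\<phi> x > 0 \<longleftrightarrow> x \<in> ball a r" for x
    by (simp add: flat_def)
  have "{p. ?\<phi> p \<noteq> 0} = ball a r"
  proof (intro set_eqI)
    show "p \<in> {p. ?\<phi> p \<noteq> 0} \<longleftrightarrow> p \<in> ball a r" for p
      using pos[of p] nonneg[of p] by (simp only: mem_Collect_eq) linarith
  qed
  moreover have "C_on k UNIV ?\<phi>" for k
    by (rule bump_algebra_C_on[OF bump_algebra.flat])
  ultimately show "test_function S ?\<phi>"
    using assms unfolding test_function_def by auto
qed

text \<open>If \<open>g p\<close> were positive, \<open>g\<close> would be positive on a ball around
  \<open>p\<close>. Testing with a bump positive exactly there gives a nonnegative integrand of
  integral zero, which vanishes almost everywhere, so the ball would be a null set.\<close>

lemma fundamental_lemma_pos: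
  fixes g :: "real^'n::finite \<Rightarrow> real"
  assumes "open S" "continuous_on S g" "p \<in> S"
    and "\<And>\<phi>. test_function S \<phi> \<Longrightarrow> (LINT p:S|lborel. g p * \<phi> p) = 0"
  shows "g p \<le> 0"
proof (rule ccontr)
  assume "\<not> g p \<le> 0"
  then have "g p > 0" by simp
  have "open (S \<inter> g -` {0<..})"
    by (rule continuous_open_preimage[OF assms(2,1) open_greaterThan])
  moreover have "p \<in> S \<inter> g -` {0<..}"
    using assms(3) \<open>g p > 0\<close> by simp
  ultimately obtain r where r: "r > 0" "cball p r \<subseteq> S \<inter> g -` {0<..}"
    unfolding open_contains_cball by blast
  have gpos: "q \<in> S" "g q > 0" if "q \<in> ball p r" for q
    using subsetD[OF r(2), of q] that by auto
  have "cball p r \<subseteq> S" using r(2) by auto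
  from exists_bump_function[OF r(1) this] obtain \<phi>
    where \<phi>: "test_function S \<phi>" "\<And>x. 0 \<le> \<phi> x" "\<And>x. \<phi> x > 0 \<longleftrightarrow> x \<in> ball p r" by blast
  have z: "\<phi> q = 0" if "q \<notin> ball p r" for q
    using \<phi>(2,3)[of q] that by auto
  let ?F = "\<lambda>q. indicator S q *\<^sub>R (g q * \<phi> q)"
  have nn: "0 \<le> ?F q" for q
  proof (cases "q \<in> ball p r")
    case True
    then show ?thesis using gpos[of q] \<phi>(2)[of q] by simp
  qed (simp add: z)
  have "integrable lborel ?F"
    using set_integrable_mult_test_function(1)[OF assms(2) \<phi>(1)] by (simp add: set_integrable_def)
  moreover have "integral\<^sup>L lborel ?F = 0"
    using assms(4)[OF \<phi>(1)] by (simp add: set_lebesgue_integral_def)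
  ultimately have "AE q in lborel. ?F q = 0"
    using nn by (subst integral_nonneg_eq_0_iff_AE[symmetric]) auto
  then have "AE q in lborel. q \<notin> ball p r"
  proof eventually_elim
    case (elim q)
    show ?case
    proof
      assume "q \<in> ball p r"
      then have "q \<in> S" "g q > 0" "\<phi> q > 0" using gpos[of q] \<phi>(3)[of q] by auto
      with elim show False by simp
    qed
  qed
  then have "emeasure lborel (ball p r) = 0"
    using AE_iff_measurable[of "ball p r" lborel "\<lambda>q. q \<notin> ball p r"] by (simp del: mem_ball)
  then show False
    using content_ball_pos[OF r(1), of p] by (simp add: measure_def)
qed

lemma fundamental_lemma:
  fixes g :: "real^'n::finite \<Rightarrow> real"
  assumes "open S" "continuous_on S g" "p \<in> S"
    and "\<And>\<phi>. test_function S \<phi> \<Longrightarrow> (LINT p:S|lborel. g p * \<phi> p) = 0"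
  shows "g p = 0"
proof -
  have "- g p \<le> 0"
    by (rule fundamental_lemma_pos[of S "\<lambda>p. - g p"])
      (use assms in \<open>auto intro: continuous_intros simp: set_integral_uminus set_lebesgue_integral_def\<close>)
  with fundamental_lemma_pos[OF assms] show ?thesis by simp
qed

section \<open>Critical maps\<close>

lemma norm_grad_power2: "(norm (grad g p))\<^sup>2 = (\<Sum>i\<in>UNIV. (partial i g p)\<^sup>2)"
  unfolding power2_norm_eq_inner by (simp add: inner_vec_def grad_def power2_eq_square)

lemma critical_map_equation:
  fixes f :: "real^'n::finite \<Rightarrow> heisenberg"
  assumes S: "open \<Omega>" and crit: "critical_map \<Omega> f" and p: "p \<in> \<Omega>"
    and Cx: "C_on 2 \<Omega> (xc f)" and Cy: "C_on 2 \<Omega> (yc f)"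
  shows "laplacian (xc f) p * partial \<gamma> (xc f) p + laplacian (yc f) p * partial \<gamma> (yc f) p = 0"
proof -
  define x where "x = xc f"
  define y where "y = yc f"
  \<comment> \<open>\<open>E\<close> is the energy density and \<open>T \<beta>\<close> the entry
    with indices \<open>\<beta>\<close>, \<open>\<gamma>\<close> of the pulled-back metric.
    \<open>G\<close> is twice the divergence of \<open>T\<close> minus the
    \<open>\<gamma>\<close>-derivative of \<open>E\<close>, the density left after integration by
    parts; it turns out to be twice the claimed expression.\<close>
  define E where "E = (\<lambda>p. \<Sum>\<beta>\<in>UNIV. (partial \<beta> x p * partial \<beta> x p + partial \<beta> y p * partial \<beta> y p))"
  define T where "T \<beta> = (\<lambda>p. partial \<beta> x p * partial \<gamma> x p + partial \<beta> y p * partial \<gamma> y p)" for \<beta>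
  define G where "G p = 2 * (\<Sum>\<beta>\<in>UNIV. partial \<beta> (T \<beta>) p) - partial \<gamma> E p" for p
  have Cx1: "C_on 1 \<Omega> (partial \<beta> x)" and Cy1: "C_on 1 \<Omega> (partial \<beta> y)" for \<beta>
    using C_on_partial[of 1 \<Omega> x \<beta>] C_on_partial[of 1 \<Omega> y \<beta>] Cx Cy
    unfolding x_def y_def by (simp_all only: numeral_2_eq_2 One_nat_def)
  have dx: "partial \<beta> x differentiable (at q)" and dy: "partial \<beta> y differentiable (at q)"
    if "q \<in> \<Omega>" for \<beta> q
    using Cx1[of \<beta>] Cy1[of \<beta>] that by auto
  have CT: "C_on 1 \<Omega> (T \<beta>)" for \<beta>
    unfolding T_def by (intro C_on_add C_on_mult S Cx1 Cy1)
  have CE: "C_on 1 \<Omega> E"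
    unfolding E_def by (intro C_on_sum C_on_add C_on_mult S Cx1 Cy1) auto
  have cont: "continuous_on \<Omega> E" "continuous_on \<Omega> (T \<beta>)"
    "continuous_on \<Omega> (partial i E)" "continuous_on \<Omega> (partial i (T \<beta>))" for \<beta> i
    using C_on_imp_continuous_on[OF CE] C_on_imp_continuous_on[OF CT]
      C_on_partial[of 0 \<Omega> E] C_on_partial[of 0 \<Omega> "T \<beta>"] CE CT[of \<beta>] by auto
  have energy: "energy_density f q = E q" for q
    unfolding energy_density_def norm_grad_power2 E_def x_def y_def
    by (simp add: sum.distrib power2_eq_square)
  \<comment> \<open>Linearity is stated for arbitrary integrands because it serves both before the
    integration by parts, with derivatives of the test function, and after it.\<close>
  have split: "(LINT q:\<Omega>|lborel. e q - 2 * (\<Sum>\<beta>\<in>UNIV. t \<beta> q))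
      = (LINT q:\<Omega>|lborel. e q) - 2 * (\<Sum>\<beta>\<in>UNIV. LINT q:\<Omega>|lborel. t \<beta> q)"
    if "set_integrable lborel \<Omega> e" "\<And>\<beta>. set_integrable lborel \<Omega> (t \<beta>)"
    for e :: "real^'n \<Rightarrow> real" and t :: "'n \<Rightarrow> real^'n \<Rightarrow> real"
  proof -
    define e' where "e' q = indicator \<Omega> q *\<^sub>R e q" for q
    define t' where "t' \<beta> q = indicator \<Omega> q *\<^sub>R t \<beta> q" for \<beta> q
    have "(\<lambda>q. indicator \<Omega> q *\<^sub>R (e q - 2 * (\<Sum>\<beta>\<in>UNIV. t \<beta> q)))
      = (\<lambda>q. e' q - 2 * (\<Sum>\<beta>\<in>UNIV. t' \<beta> q))"
      by (auto simp: fun_eq_iff indicator_def e'_def t'_def)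
    moreover have "integrable lborel e'" "\<And>\<beta>. integrable lborel (t' \<beta>)"
      using that by (simp_all add: set_integrable_def e'_def[abs_def] t'_def[abs_def])
    ultimately have "(LINT q:\<Omega>|lborel. e q - 2 * (\<Sum>\<beta>\<in>UNIV. t \<beta> q))
        = integral\<^sup>L lborel e' - 2 * (\<Sum>\<beta>\<in>UNIV. integral\<^sup>L lborel (t' \<beta>))"
      unfolding set_lebesgue_integral_def by simp
    then show ?thesis
      by (simp add: set_lebesgue_integral_def e'_def[abs_def] t'_def[abs_def])
  qed
  have "G p = 0"
  proof (rule fundamental_lemma[OF S _ p])
    show "continuous_on \<Omega> G"
      unfolding G_def by (intro continuous_intros cont)
    fix \<phi> assume \<phi>: "test_function \<Omega> \<phi>"
    note int = set_integrable_mult_test_function[OF _ \<phi>]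
    have "0 = (LINT q:\<Omega>|lborel. E q * partial \<gamma> \<phi> q - 2 * (\<Sum>\<beta>\<in>UNIV. T \<beta> q * partial \<beta> \<phi> q))"
      using crit[unfolded critical_map_def, rule_format, OF \<phi>, of \<gamma>]
      by (simp add: energy T_def x_def y_def)
    also have "\<dots> = (LINT q:\<Omega>|lborel. E q * partial \<gamma> \<phi> q)
        - 2 * (\<Sum>\<beta>\<in>UNIV. LINT q:\<Omega>|lborel. T \<beta> q * partial \<beta> \<phi> q)"
      by (rule split) (use int(2) cont in auto)
    also have "\<dots> = - (LINT q:\<Omega>|lborel. partial \<gamma> E q * \<phi> q)
        + 2 * (\<Sum>\<beta>\<in>UNIV. LINT q:\<Omega>|lborel. partial \<beta> (T \<beta>) q * \<phi> q)"
      by (simp add: integration_by_parts_test_function[OF S _ \<phi>] CE CT sum_negf del: One_nat_def)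
    also have "\<dots> = - (LINT q:\<Omega>|lborel. partial \<gamma> E q * \<phi> q - 2 * (\<Sum>\<beta>\<in>UNIV. partial \<beta> (T \<beta>) q * \<phi> q))"
      by (subst split) (use int(1) cont in auto)
    also have "\<dots> = (LINT q:\<Omega>|lborel. G q * \<phi> q)"
      unfolding set_lebesgue_integral_def integral_minus[symmetric]
      by (rule Bochner_Integration.integral_cong) (simp_all add: G_def algebra_simps sum_distrib_left)
    finally show "(LINT q:\<Omega>|lborel. G q * \<phi> q) = 0" by simp
  qed
  moreover have "partial \<gamma> E p = 2 * (\<Sum>\<beta>\<in>UNIV. partial \<beta> x p * partial \<gamma> (partial \<beta> x) p
      + partial \<beta> y p * partial \<gamma> (partial \<beta> y) p)"
    unfolding E_def using dx[OF p] dy[OF p]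
    by (simp add: partial_sum partial_add partial_mult sum_distrib_left algebra_simps)
  \<comment> \<open>Symmetry of second derivatives brings the mixed terms into the order in which
    they occur in \<open>partial \<gamma> E p\<close>, so that they cancel in
    \<open>G p\<close>.\<close>
  moreover have "partial \<beta> (T \<beta>) p = partial \<beta> x p * partial \<gamma> (partial \<beta> x) p
      + partial \<beta> y p * partial \<gamma> (partial \<beta> y) p
      + (partial \<beta> (partial \<beta> x) p * partial \<gamma> x p + partial \<beta> (partial \<beta> y) p * partial \<gamma> y p)" for \<beta>
    unfolding T_def using dx[OF p] dy[OF p] partial_commute[OF Cx S p, of \<beta> \<gamma>] partial_commute[OF Cy S p, of \<beta> \<gamma>]
    by (simp add: partial_add partial_mult x_def y_def)
  ultimately have "(\<Sum>\<beta>\<in>UNIV. partial \<beta> (partial \<beta> x) p * partial \<gamma> x p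
      + partial \<beta> (partial \<beta> y) p * partial \<gamma> y p) = 0"
    by (simp add: G_def sum.distrib)
  then show ?thesis
    by (simp add: laplacian_def sum.distrib sum_distrib_right x_def y_def)
qed

section \<open>Composition with the profile \<open>H\<close>, and the Laplacian of the
  modulus\<close>

lemma
  fixes y :: "real^'n::finite \<Rightarrow> real"
  assumes "open \<Omega>" "p \<in> \<Omega>" "y ` \<Omega> \<subseteq> I" "y differentiable (at p)"
    and "(H has_real_derivative d) (at (y p) within I)"
  shows differentiable_compose_within: "(\<lambda>q. H (y q)) differentiable (at p)"
    and partial_compose_within: "partial i (\<lambda>q. H (y q)) p = d * partial i y p"
proof -
  \<comment> \<open>\<open>H\<close> has only a derivative within \<open>I\<close>, one-sided at an
    endpoint. Since \<open>y\<close> maps \<open>\<Omega>\<close> into \<open>I\<close>, the chain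
    rule applies within \<open>\<Omega>\<close>, and openness of \<open>\<Omega>\<close> turns the
    result into a full derivative at \<open>p\<close>.\<close>
  have "(y has_derivative frechet_derivative y (at p)) (at p within \<Omega>)"
    using assms(4) by (simp add: frechet_derivative_works has_derivative_at_withinI)
  moreover have "(H has_derivative (*) d) (at (y p) within y ` \<Omega>)"
    using assms(3,5) has_derivative_subset unfolding has_field_derivative_def by blast
  ultimately have "((\<lambda>q. H (y q)) has_derivative (\<lambda>v. d * frechet_derivative y (at p) v)) (at p within \<Omega>)"
    by (rule has_derivative_in_compose)
  then have D: "((\<lambda>q. H (y q)) has_derivative (\<lambda>v. d * frechet_derivative y (at p) v)) (at p)"
    by (simp add: at_within_open[OF assms(2,1)])
  then show "(\<lambda>q. H (y q)) differentiable (at p)" by (auto simp: differentiable_def)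
  show "partial i (\<lambda>q. H (y q)) p = d * partial i y p"
    using partial_eqI[OF D] by (simp add: partial_def)
qed

text \<open>The square root is never differentiated twice: differentiating
  \<open>u * u = x * x + y * y\<close> once gives a formula for \<open>u * partial i u\<close>,
  differentiating that formula gives the second-order identity, and summation over \<open>i\<close>
  finishes.\<close>

lemma laplacian_modulus:
  fixes x y :: "real^'n::finite \<Rightarrow> real"
  defines "u \<equiv> \<lambda>q. sqrt ((x q)\<^sup>2 + (y q)\<^sup>2)"
  assumes S: "open \<Omega>" and p: "p \<in> \<Omega>" and Cx: "C_on 2 \<Omega> x" and Cy: "C_on 2 \<Omega> y" and "u p \<noteq> 0"
  shows "u p * laplacian u p + (norm (grad u p))\<^sup>2
    = (norm (grad x p))\<^sup>2 + (norm (grad y p))\<^sup>2 + x p * laplacian x p + y p * laplacian y p"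
proof -
  have C1: "C_on (Suc (Suc 0)) \<Omega> x" "C_on (Suc (Suc 0)) \<Omega> y"
    using Cx Cy by (simp_all only: numeral_2_eq_2)
  have d1: "x differentiable (at q)" "y differentiable (at q)" if "q \<in> \<Omega>" for q
    using C1 that by auto
  have d2: "partial i x differentiable (at q)" "partial i y differentiable (at q)" if "q \<in> \<Omega>" for q i
    using C_on_partial[OF C1(1), of i] C_on_partial[OF C1(2), of i] that by auto
  \<comment> \<open>The first-order identity has to hold on a neighbourhood of \<open>p\<close> to
    be differentiated again, hence the open set on which \<open>u\<close> is positive.\<close>
  define W where "W = {q\<in>\<Omega>. (x q)\<^sup>2 + (y q)\<^sup>2 \<noteq> 0}"
  have "continuous_on \<Omega> (\<lambda>q. (x q)\<^sup>2 + (y q)\<^sup>2)"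
    using C_on_imp_continuous_on[OF Cx] C_on_imp_continuous_on[OF Cy] by (intro continuous_intros)
  then have "open (\<Omega> \<inter> (\<lambda>q. (x q)\<^sup>2 + (y q)\<^sup>2) -` (- {0}))"
    by (intro continuous_open_preimage S) auto
  then have W: "open W" by (simp add: W_def vimage_def Int_def)
  have pW: "p \<in> W" using assms(6) p by (auto simp: W_def u_def)
  have upos: "u q > 0" if "q \<in> W" for q
    using that by (simp add: W_def u_def sum_power2_gt_zero_iff)
  have du: "u differentiable (at q)" if "q \<in> W" for q
  proof -
    have "(\<lambda>q. (x q)\<^sup>2 + (y q)\<^sup>2) differentiable (at q)"
      using d1 that by (simp add: W_def)
    moreover have "sqrt differentiable (at ((x q)\<^sup>2 + (y q)\<^sup>2))"
      using DERIV_real_sqrt upos[OF that] real_differentiable_def unfolding u_def by (metis real_sqrt_gt_0_iff)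
    ultimately show ?thesis
      using differentiable_chain_at by (fastforce simp: u_def o_def)
  qed
  have pu: "u q * partial i u q = x q * partial i x q + y q * partial i y q" if "q \<in> W" for q i
  proof -
    have q: "q \<in> \<Omega>" using that by (simp add: W_def)
    have "partial i (\<lambda>q. u q * u q) q = partial i (\<lambda>q. x q * x q + y q * y q) q"
      by (simp add: u_def power2_eq_square)
    then show ?thesis
      using d1[OF q] du[OF that] by (simp add: partial_mult partial_add)
  qed
  \<comment> \<open>The second product rule needs \<open>partial i u\<close> to be differentiable;
    near \<open>p\<close> it equals the differentiable quotient \<open>?h\<close>, by
    \<open>pu\<close>.\<close>
  have "partial i u differentiable (at p)" for i
  proof -
    let ?h = "\<lambda>q. (x q * partial i x q + y q * partial i y q) / u q"
    have "?h differentiable (at p)"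
      using d1[OF p] d2[OF p] du[OF pW] upos[OF pW] by (intro differentiable_divide) auto
    moreover have "?h q = partial i u q" if "q \<in> W" for q
      using pu[OF that, of i] upos[OF that] by (simp add: field_simps)
    ultimately show ?thesis
      unfolding differentiable_def using has_derivative_transform_within_open[OF _ W pW, of ?h] by blast
  qed
  note dpu = this
  have "u p * partial i (partial i u) p + (partial i u p)\<^sup>2
     = (partial i x p)\<^sup>2 + (partial i y p)\<^sup>2 + x p * partial i (partial i x) p + y p * partial i (partial i y) p" for i
  proof -
    have "partial i (\<lambda>q. u q * partial i u q) p
        = partial i (\<lambda>q. x q * partial i x q + y q * partial i y q) p"
      by (rule partial_cong[OF W pW pu]) (use du[OF pW] dpu in auto)
    then show ?thesis
      using d1[OF p] d2[OF p] du[OF pW] dpu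
      by (simp add: partial_mult partial_add power2_eq_square)
  qed
  then have "(\<Sum>i\<in>UNIV. u p * partial i (partial i u) p + (partial i u p)\<^sup>2)
    = (\<Sum>i\<in>UNIV. (partial i x p)\<^sup>2 + (partial i y p)\<^sup>2 + x p * partial i (partial i x) p + y p * partial i (partial i y) p)"
    by simp
  then show ?thesis
    by (simp add: laplacian_def norm_grad_power2 sum.distrib sum_distrib_left)
qed

lemma laplacian_compose:
  fixes y :: "real^'n::finite \<Rightarrow> real"
  assumes S: "open \<Omega>" and p: "p \<in> \<Omega>" and Cy: "C_on 2 \<Omega> y" and I: "y ` \<Omega> \<subseteq> I"
    and x: "\<And>q. q \<in> \<Omega> \<Longrightarrow> x q = H (y q)"
    and H: "\<And>s. s \<in> I \<Longrightarrow> (H has_real_derivative H' s) (at s within I)"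
    and H': "\<And>s. s \<in> I \<Longrightarrow> (H' has_real_derivative H'' s) (at s within I)"
  shows "partial i x p = H' (y p) * partial i y p" (is ?P)
    and "laplacian x p = H'' (y p) * (norm (grad y p))\<^sup>2 + H' (y p) * laplacian y p" (is ?L)
proof -
  have C1: "C_on (Suc (Suc 0)) \<Omega> y"
    using Cy by (simp only: numeral_2_eq_2)
  have yI: "y q \<in> I" if "q \<in> \<Omega>" for q using I that by auto
  have dy: "y differentiable (at q)" "partial i y differentiable (at q)" if "q \<in> \<Omega>" for i q
    using C1 C_on_partial[OF C1, of i] that by auto
  have dH: "(\<lambda>q. H (y q)) differentiable (at q)" "(\<lambda>q. H' (y q)) differentiable (at q)"
    "partial i (\<lambda>q. H (y q)) q = H' (y q) * partial i y q"
    "partial i (\<lambda>q. H' (y q)) q = H'' (y q) * partial i y q"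
    if "q \<in> \<Omega>" for i q
    using differentiable_compose_within[OF S that I dy(1)[OF that]]
      partial_compose_within[OF S that I dy(1)[OF that]] H[OF yI[OF that]] H'[OF yI[OF that]] by blast+
  have px: "partial i x q = H' (y q) * partial i y q" if "q \<in> \<Omega>" for i q
    using partial_cong[OF S that, of "\<lambda>q. H (y q)" x i] x dH(1,3)[OF that] by simp
  then show ?P using p .
  have "partial i (partial i x) p = H'' (y p) * (partial i y p)\<^sup>2 + H' (y p) * partial i (partial i y) p" for i
  proof -
    have "partial i (\<lambda>q. H' (y q) * partial i y q) p = partial i (partial i x) p"
      by (rule partial_cong[OF S p]) (use px dH(2)[OF p] dy(2)[OF p] in auto)
    then show ?thesis
      using partial_mult[OF dH(2)[OF p] dy(2)[OF p], of i i] dH(4)[OF p, of i]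
      by (simp add: power2_eq_square algebra_simps)
  qed
  then show ?L
    by (simp add: laplacian_def norm_grad_power2 sum.distrib sum_distrib_left)
qed

text \<open>The weak equation only gives the claim where the gradient of \<open>y\<close> is nonzero; but an open set on
  which the left-hand side does not vanish would be one on which \<open>y\<close> is locally constant.\<close>

lemma critical_graph_equation:
  fixes f :: "real^'n::finite \<Rightarrow> heisenberg"
  assumes S: "open \<Omega>" and crit: "critical_map \<Omega> f" and p: "p \<in> \<Omega>"
    and Cx: "C_on 2 \<Omega> (xc f)" and Cy: "C_on 2 \<Omega> (yc f)"
    and I: "yc f ` \<Omega> \<subseteq> I"
    and x: "\<And>q. q \<in> \<Omega> \<Longrightarrow> xc f q = H (yc f q)"
    and H: "\<And>s. s \<in> I \<Longrightarrow> (H has_real_derivative H' s) (at s within I)"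
    and H': "\<And>s. s \<in> I \<Longrightarrow> (H' has_real_derivative H'' s) (at s within I)"
    and H'': "continuous_on I H''"
  shows "(1 + (H' (yc f p))\<^sup>2) * laplacian (yc f) p
    + H' (yc f p) * H'' (yc f p) * (norm (grad (yc f) p))\<^sup>2 = 0"
proof (rule ccontr)
  define y where "y = yc f"
  define Q where "Q q = (1 + (H' (y q))\<^sup>2) * laplacian y q + H' (y q) * H'' (y q) * (norm (grad y q))\<^sup>2" for q
  assume "\<not> ?thesis"
  then have Qp: "Q p \<noteq> 0" by (simp add: Q_def y_def)
  \<comment> \<open>Inserting the chain rule formulas for \<open>x = H \<circ> y\<close> into
    \<open>critical_map_equation\<close> makes \<open>partial \<gamma> y q\<close> a common
    factor.\<close>
  have factor: "Q q * partial \<gamma> y q = 0" if "q \<in> \<Omega>" for q \<gamma>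
    using critical_map_equation[OF S crit that Cx Cy, of \<gamma>]
      laplacian_compose[where x="xc f" and y="yc f" and H=H, OF S that Cy I x H H']
    by (simp add: Q_def y_def power2_eq_square algebra_simps)
  have C: "C_on (Suc (Suc 0)) \<Omega> y"
    using Cy by (simp only: numeral_2_eq_2 y_def)
  have cy: "continuous_on \<Omega> y" "continuous_on \<Omega> (partial i y)" "continuous_on \<Omega> (partial j (partial i y))" for i j
    using C_on_imp_continuous_on[OF C] C_on_imp_continuous_on[OF C_on_partial[OF C, of i]]
      C_on_imp_continuous_on[OF C_on_partial[OF C_on_partial[OF C, of i], of j]] by auto
  have "continuous_on I H'"
    by (metis H' DERIV_continuous continuous_on_eq_continuous_within)
  then have "continuous_on \<Omega> (\<lambda>q. H' (y q))" "continuous_on \<Omega> (\<lambda>q. H'' (y q))"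
    using continuous_on_compose2[OF _ cy(1)] H'' I by (auto simp: y_def)
  then have "continuous_on \<Omega> Q"
    unfolding Q_def norm_grad_power2 laplacian_def by (intro continuous_intros cy)
  then have "open (\<Omega> \<inter> Q -` (- {0}))"
    by (intro continuous_open_preimage S) auto
  moreover have "p \<in> \<Omega> \<inter> Q -` (- {0})" using p Qp by auto
  moreover have "partial \<gamma> y q = 0" if "q \<in> \<Omega> \<inter> Q -` (- {0})" for \<gamma> q
    using factor[of q \<gamma>] that by auto
  \<comment> \<open>The gradient of \<open>y\<close> vanishes on a whole neighbourhood of
    \<open>p\<close>, so the pure second derivatives vanish at \<open>p\<close> too, and with them
    both terms of \<open>Q p\<close>.\<close>
  ultimately have "partial \<gamma> y p = 0" "partial \<gamma> (\<lambda>q. 0) p = partial \<gamma> (partial \<gamma> y) p" for \<gamma>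
    by (blast, intro partial_cong[of "\<Omega> \<inter> Q -` (- {0})"]) auto
  then have "partial \<gamma> y p = 0" "partial \<gamma> (partial \<gamma> y) p = 0" for \<gamma>
    by (simp_all add: partial_const)
  then have "Q p = 0"
    by (simp add: Q_def laplacian_def norm_grad_power2)
  with Qp show False by simp
qed

section \<open>The differential inequality\<close>

lemma modulus_inequality_algebra:
  fixes h h' h'' s g L :: real
  assumes "(1 + h'\<^sup>2) * L + h' * h'' * g = 0" "h'' * (h - s * h') \<ge> 0" "g \<ge> 0"
  shows "h'\<^sup>2 * g + g + h * (h'' * g + h' * L) + s * L \<ge> 0"
proof -
  \<comment> \<open>Multiplying by this positive factor keeps the sign and lets \<open>L\<close> be
    replaced through the first hypothesis. What remains is a square times \<open>g\<close> plus the
    second hypothesis times \<open>g\<close>.\<close>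
  have pos: "1 + h'\<^sup>2 > 0" by (simp add: add_pos_nonneg)
  have "(1 + h'\<^sup>2) * (h'\<^sup>2 * g + g + h * (h'' * g + h' * L) + s * L)
      = (1 + h'\<^sup>2) * (1 + h'\<^sup>2) * g + (1 + h'\<^sup>2) * h * h'' * g + (h * h' + s) * ((1 + h'\<^sup>2) * L)"
    by (simp add: algebra_simps)
  also have "(1 + h'\<^sup>2) * L = - h' * h'' * g" using assms(1) by simp
  also have "(1 + h'\<^sup>2) * (1 + h'\<^sup>2) * g + (1 + h'\<^sup>2) * h * h'' * g + (h * h' + s) * (- h' * h'' * g)
      = (1 + h'\<^sup>2)\<^sup>2 * g + h'' * (h - s * h') * g"
    by (simp add: algebra_simps power2_eq_square)
  also have "\<dots> \<ge> 0"
    using assms(2,3) by simp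
  finally show ?thesis
    using pos by (simp add: zero_le_mult_iff)
qed

theorem proposition4p4:
  fixes \<Omega> :: "(real^'n::finite) set"
    and f :: "real^'n \<Rightarrow> heisenberg"
    and I :: "real set"
    and H H' H'' :: "real \<Rightarrow> real"
  assumes "open \<Omega>"
    and "harmonic_curve \<Omega> f"
    and "is_interval I"
    and "yc f ` \<Omega> \<subseteq> I"
    and "\<And>s. s \<in> I \<Longrightarrow> (H has_real_derivative H' s) (at s within I)"
    and "\<And>s. s \<in> I \<Longrightarrow> (H' has_real_derivative H'' s) (at s within I)"
    and "continuous_on I H''"
    and "\<And>p. p \<in> \<Omega> \<Longrightarrow> zc f p = Complex (H (yc f p)) (yc f p)"
  shows "((\<forall>s \<in> yc f ` \<Omega>. H'' s * (H s - s * H' s) \<ge> 0) \<longrightarrow>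
            (\<forall>p\<in>\<Omega>. cmod (zc f p) \<noteq> 0 \<longrightarrow>
               laplacian (\<lambda>q. cmod (zc f q)) p
                 + (norm (grad (\<lambda>q. cmod (zc f q)) p))\<^sup>2 / cmod (zc f p) \<ge> 0))
       \<and> ((\<forall>s \<in> yc f ` \<Omega>. s \<ge> 0 \<and> H s \<ge> 0 \<and> H' s \<le> 0 \<and> H'' s \<ge> 0) \<longrightarrow>
            (\<forall>p\<in>\<Omega>. cmod (zc f p) \<noteq> 0 \<longrightarrow>
               laplacian (\<lambda>q. cmod (zc f q)) p
                 + (norm (grad (\<lambda>q. cmod (zc f q)) p))\<^sup>2 / cmod (zc f p) \<ge> 0))"
proof -
  have Cf: "C_on 2 \<Omega> f" and crit: "critical_map \<Omega> f"
    using assms(2) by (auto simp: harmonic_curve_def simp del: C_on.simps)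
  have "bounded_linear (\<lambda>q::heisenberg. Re (fst q))" "bounded_linear (\<lambda>q::heisenberg. Im (fst q))"
    by (intro bounded_linear_compose[OF bounded_linear_Re] bounded_linear_compose[OF bounded_linear_Im]
        bounded_linear_fst)+
  from this[THEN C_on_bounded_linear[OF assms(1) _ Cf]]
  have Cx: "C_on 2 \<Omega> (xc f)" and Cy: "C_on 2 \<Omega> (yc f)" by simp_all
  have x: "xc f q = H (yc f q)" if "q \<in> \<Omega>" for q
    using arg_cong[OF assms(8)[OF that], of Re] by simp
  \<comment> \<open>The sign condition is imposed only at the value of \<open>y\<close> at the point
    considered, so both claims of the theorem reduce to this pointwise statement.\<close>
  have main: "laplacian (\<lambda>q. cmod (zc f q)) p + (norm (grad (\<lambda>q. cmod (zc f q)) p))\<^sup>2 / cmod (zc f p) \<ge> 0"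
    if p: "p \<in> \<Omega>" and nz: "cmod (zc f p) \<noteq> 0" and cond: "H'' (yc f p) * (H (yc f p) - yc f p * H' (yc f p)) \<ge> 0"
    for p
  proof -
    note lap = laplacian_compose[where x="xc f" and y="yc f" and H=H, OF assms(1) p Cy assms(4) x assms(5,6)]
    have lx: "laplacian (xc f) p = H'' (yc f p) * (norm (grad (yc f) p))\<^sup>2 + H' (yc f p) * laplacian (yc f) p"
      by (rule lap(2))
    have gx: "(norm (grad (xc f) p))\<^sup>2 = (H' (yc f p))\<^sup>2 * (norm (grad (yc f) p))\<^sup>2"
      by (simp add: norm_grad_power2 lap(1) power_mult_distrib sum_distrib_left)
    have "cmod (zc f p) * laplacian (\<lambda>q. cmod (zc f q)) p + (norm (grad (\<lambda>q. cmod (zc f q)) p))\<^sup>2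
      = (norm (grad (xc f) p))\<^sup>2 + (norm (grad (yc f) p))\<^sup>2
        + xc f p * laplacian (xc f) p + yc f p * laplacian (yc f) p"
      using laplacian_modulus[OF assms(1) p Cx Cy] nz by (simp add: cmod_def)
    also have "\<dots> \<ge> 0"
      unfolding gx lx x[OF p]
      by (rule modulus_inequality_algebra[OF critical_graph_equation[OF assms(1) crit p Cx Cy assms(4) x assms(5-7)] cond])
        auto
    \<comment> \<open>The inequality so far is the claim multiplied by the modulus, which is
      positive at \<open>p\<close>.\<close>
    finally show ?thesis
      using nz by (simp add: field_simps)
  qed
  \<comment> \<open>With \<open>s \<ge> 0\<close> and \<open>H' s \<le> 0\<close> the term
    \<open>- s * H' s\<close> is nonnegative, so \<open>H s - s * H' s\<close> is too. The sign of
    \<open>s\<close> matters: for negative \<open>s\<close> that term would be nonpositive.\<close>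
  moreover have "H'' s * (H s - s * H' s) \<ge> 0"
    if "s \<ge> 0 \<and> H s \<ge> 0 \<and> H' s \<le> 0 \<and> H'' s \<ge> 0" for s
    using that mult_nonneg_nonpos[of s "H' s"] by (intro mult_nonneg_nonneg) auto
  ultimately show ?thesis by blast
qed

end
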